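(* Let $Q:\mathbb{R}^n\to\mathbb{R}^n$ and $S_k:\mathbb{R}^n\to\mathbb{R}^n$, $k\ge 0$, be strictly nonexpansive, and define $T_k(x):=S_k(Q(x))$ for all $x\in\mathbb{R}^n$ and $k\ge 0$. Assume that $F:=\bigcap_{k=0}^{\infty}\{x\in\mathbb{R}^n\mid T_k(x)=x\}$ is nonempty, and that for any sequence $\{x^k\}_{k=0}^{\infty}$ generated by $x^0\in\mathbb{R}^n$ arbitrary and $x^{k+1}=S_{k+1}(Q(x^k))$ for all $k\ge 0$, the following holds: for every $\ell\ge 0$ there exists an index $k(\ell)\ge 0$ such that $$\|T_{k+1}(x^k)-z\|\le\|T_\ell(x^k)-z\|\quad\text{for all } z\in F\text{ and all }k\ge k(\ell).$$ Then any sequence $\{x^k\}_{k=0}^{\infty}$ generated by $x^0\in\mathbb{R}^n$ arbitrary and $x^{k+1}=S_{k+1}(Q(x^k))$, $k\ge 0$, converges to an element of $F$.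
   Context: $\|\cdot\|$ is the Euclidean norm on $\mathbb{R}^n$. An operator $T:\mathbb{R}^n\to\mathbb{R}^n$ is called strictly nonexpansive if for all $x,y\in\mathbb{R}^n$: (i) $\|T(x)-T(y)\|\le\|x-y\|$, and (ii) if $\|T(x)-T(y)\|=\|x-y\|$ then $T(x)-T(y)=x-y$. *)

theory Defs
  imports "HOL-Analysis.Analysis"
begin

definition strictly_nonexpansive :: "(real ^ 'n \<Rightarrow> real ^ 'n) \<Rightarrow> bool" where
  "strictly_nonexpansive T \<longleftrightarrow>
     (\<forall>x y. norm (T x - T y) \<le> norm (x - y) \<and>
            (norm (T x - T y) = norm (x - y) \<longrightarrow> T x - T y = x - y))"

end

(* Each T k = S k \<circ> Q is strictly nonexpansive, so orbits are Fejer monotone with respect to F.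
   For a cluster point p and z in F, the hypothesis squeezes norm (T l (x k) - z) between two
   consecutive distances to z, whence norm (T l p - z) = norm (p - z) and strictness gives
   T l p = p. Fejer monotonicity with respect to p then upgrades subsequential convergence to
   convergence. *)

theory Submission
  imports Defs
begin

lemma strictly_nonexpansive_norm_le:
  "strictly_nonexpansive T \<Longrightarrow> norm (T x - T y) \<le> norm (x - y)"
  by (simp add: strictly_nonexpansive_def)

lemma strictly_nonexpansive_isometric_pair:
  "strictly_nonexpansive T \<Longrightarrow> norm (T x - T y) = norm (x - y) \<Longrightarrow> T x - T y = x - y"
  by (simp add: strictly_nonexpansive_def)

text \<open>Equality for the composite collapses the chain \<open>norm (S (Q x) - S (Q y))\<close>
  \<le> \<open>norm (Q x - Q y)\<close> \<le> \<open>norm (x - y)\<close>, so strictness applies to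
  \<open>S\<close> and to \<open>Q\<close> separately and the two vector identities chain.\<close>

lemma strictly_nonexpansive_compose:
  assumes S: "strictly_nonexpansive S" and Q: "strictly_nonexpansive Q"
  shows "strictly_nonexpansive (\<lambda>x. S (Q x))"
  unfolding strictly_nonexpansive_def
proof (intro allI conjI impI)
  fix x y
  have SQ: "norm (S (Q x) - S (Q y)) \<le> norm (Q x - Q y)"
    by (rule strictly_nonexpansive_norm_le[OF S])
  have Qxy: "norm (Q x - Q y) \<le> norm (x - y)"
    by (rule strictly_nonexpansive_norm_le[OF Q])
  show "norm (S (Q x) - S (Q y)) \<le> norm (x - y)"
    using SQ Qxy by linarith
  assume "norm (S (Q x) - S (Q y)) = norm (x - y)"
  then have "norm (S (Q x) - S (Q y)) = norm (Q x - Q y)" "norm (Q x - Q y) = norm (x - y)"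
    using SQ Qxy by linarith+
  then show "S (Q x) - S (Q y) = x - y"
    using strictly_nonexpansive_isometric_pair[OF S] strictly_nonexpansive_isometric_pair[OF Q]
    by metis
qed

text \<open>A nonexpansive map is 1-Lipschitz, hence continuous; this carries \<open>T l\<close>
  through the limit along a subsequence.\<close>

lemma strictly_nonexpansive_tendsto:
  assumes T: "strictly_nonexpansive T" and u: "(u \<longlongrightarrow> p) A"
  shows "((\<lambda>j. T (u j)) \<longlongrightarrow> T p) A"
proof (rule metric_tendsto_imp_tendsto[OF u])
  show "\<forall>\<^sub>F j in A. dist (T (u j)) (T p) \<le> dist (u j) p"
    by (simp add: dist_norm strictly_nonexpansive_norm_le[OF T])
qed

text \<open>Monotonicity and the lower bound already give a limit, so any subsequence identifies it.
  It is applied to distances from the orbit to a point of \<open>F\<close>.\<close>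

lemma decseq_subseq_LIMSEQ:
  fixes d :: "nat \<Rightarrow> real"
  assumes "decseq d" and "\<And>k. c \<le> d k" and "strict_mono r" and "(\<lambda>j. d (r j)) \<longlonglongrightarrow> L"
  shows "d \<longlonglongrightarrow> L"
proof -
  obtain M where M: "d \<longlonglongrightarrow> M"
    using decseq_convergent[OF assms(1), of c] assms(2) by blast
  then have "(\<lambda>j. d (r j)) \<longlonglongrightarrow> M"
    using LIMSEQ_subseq_LIMSEQ[OF M assms(3)] by (simp add: o_def)
  then show ?thesis
    using M assms(4) LIMSEQ_unique by blast
qed

theorem mainTheorem2:
  fixes Q :: "real ^ 'n \<Rightarrow> real ^ 'n"
    and S T :: "nat \<Rightarrow> real ^ 'n \<Rightarrow> real ^ 'n"
    and F :: "(real ^ 'n) set"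
  assumes Q: "strictly_nonexpansive Q"
    and S: "\<And>k. strictly_nonexpansive (S k)"
    and T_def: "\<And>k x. T k x = S k (Q x)"
    and F_def: "F = (\<Inter>k. {x. T k x = x})"
    and F_nonempty: "F \<noteq> {}"
    and eventually_closer:
      "\<And>x :: nat \<Rightarrow> real ^ 'n. (\<forall>k. x (Suc k) = S (Suc k) (Q (x k))) \<Longrightarrow>
         \<forall>l. \<exists>k0. \<forall>z\<in>F. \<forall>k\<ge>k0.
           norm (T (Suc k) (x k) - z) \<le> norm (T l (x k) - z)"
  shows "\<forall>x :: nat \<Rightarrow> real ^ 'n. (\<forall>k. x (Suc k) = S (Suc k) (Q (x k))) \<longrightarrow>
           (\<exists>p\<in>F. x \<longlonglongrightarrow> p)"
proof (intro allI impI)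
  fix x :: "nat \<Rightarrow> real ^ 'n"
  assume x: "\<forall>k. x (Suc k) = S (Suc k) (Q (x k))"
  have T: "strictly_nonexpansive (T l)" for l
    using strictly_nonexpansive_compose[OF S Q, of l] T_def[of l] by presburger
  have fixed: "T l z = z" if "z \<in> F" for l z
    using that by (auto simp: F_def)
  have T_closer: "norm (T l y - z) \<le> norm (y - z)" if "z \<in> F" for l y z
    using strictly_nonexpansive_norm_le[OF T, of l y z] fixed[OF that] by simp
  have x_Suc: "x (Suc k) = T (Suc k) (x k)" for k
    using x T_def by metis
  have fejer: "decseq (\<lambda>k. norm (x k - z))" if "z \<in> F" for z
    unfolding decseq_Suc_iff x_Suc using T_closer[OF that] by blast
  obtain z where z: "z \<in> F"
    using F_nonempty by blast
  \<comment> \<open>Fejer monotonicity keeps the orbit in a closed ball, which is compact in finite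
    dimension; this yields the cluster point \<open>p\<close>.\<close>
  have "x k \<in> cball z (norm (x 0 - z))" for k
    using decseqD[OF fejer[OF z], of 0 k] by (simp add: dist_norm norm_minus_commute)
  then obtain p r where r: "strict_mono r" and "(x \<circ> r) \<longlonglongrightarrow> p"
    using compact_imp_seq_compact[OF compact_cball] unfolding seq_compact_def by metis
  then have p: "(\<lambda>j. x (r j)) \<longlonglongrightarrow> p"
    by (simp add: o_def)
  have dist_r: "(\<lambda>j. norm (x (r j) - z)) \<longlonglongrightarrow> norm (p - z)"
    by (intro tendsto_intros p)
  \<comment> \<open>Convergence along all of \<open>k\<close> is needed, since the indices
    \<open>Suc (r j)\<close> of the lower bound below need not lie in the range of
    \<open>r\<close>.\<close>
  then have "(\<lambda>k. norm (x k - z)) \<longlonglongrightarrow> norm (p - z)"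
    using decseq_subseq_LIMSEQ[OF fejer[OF z] norm_ge_zero r] by blast
  then have dist_Suc_r: "(\<lambda>j. norm (x (Suc (r j)) - z)) \<longlonglongrightarrow> norm (p - z)"
    using LIMSEQ_subseq_LIMSEQ[OF LIMSEQ_Suc r] unfolding o_def by blast
  have "T l p = p" for l
  proof -
    obtain k0 where k0: "norm (x (Suc k) - z) \<le> norm (T l (x k) - z)" if "k \<ge> k0" for k
      using eventually_closer[OF x] z unfolding x_Suc by blast
    \<comment> \<open>The threshold \<open>k0\<close> for \<open>k\<close> also serves for
      \<open>j\<close>, because \<open>j\<close> \<le> \<open>r j\<close>.\<close>
    have "\<forall>\<^sub>F j in sequentially. norm (x (Suc (r j)) - z) \<le> norm (T l (x (r j)) - z)"
      using k0 order_trans[OF _ seq_suble[OF r]] unfolding eventually_sequentially by blast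
    moreover have "\<forall>\<^sub>F j in sequentially. norm (T l (x (r j)) - z) \<le> norm (x (r j) - z)"
      using T_closer[OF z] by simp
    ultimately have "(\<lambda>j. norm (T l (x (r j)) - z)) \<longlonglongrightarrow> norm (p - z)"
      by (rule tendsto_sandwich[OF _ _ dist_Suc_r dist_r])
    moreover have "(\<lambda>j. norm (T l (x (r j)) - z)) \<longlonglongrightarrow> norm (T l p - z)"
      by (intro tendsto_intros strictly_nonexpansive_tendsto[OF T] p)
    \<comment> \<open>Writing the fixed point \<open>z\<close> as \<open>T l z\<close> exhibits
      \<open>p\<close> and \<open>z\<close> as a pair whose distance \<open>T l\<close>
      preserves.\<close>
    ultimately have "norm (T l p - T l z) = norm (p - z)"
      using LIMSEQ_unique fixed[OF z] by metis
    from strictly_nonexpansive_isometric_pair[OF T this] show ?thesis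
      by (simp add: fixed[OF z])
  qed
  then have pF: "p \<in> F"
    by (simp add: F_def)
  \<comment> \<open>With \<open>p\<close> in \<open>F\<close>, the distances to \<open>p\<close>
    itself are decreasing, so their vanishing along \<open>r\<close> forces them to vanish along the
    whole orbit.\<close>
  have "(\<lambda>j. norm (x (r j) - p)) \<longlonglongrightarrow> 0"
    by (rule tendsto_norm_zero[OF LIM_zero[OF p]])
  then have "(\<lambda>k. norm (x k - p)) \<longlonglongrightarrow> 0"
    using decseq_subseq_LIMSEQ[OF fejer[OF pF] norm_ge_zero r] by blast
  then have "x \<longlonglongrightarrow> p"
    by (rule LIM_zero_cancel[OF tendsto_norm_zero_cancel])
  then show "\<exists>p\<in>F. x \<longlonglongrightarrow> p"
    using pF by blast
qed

end
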